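(* Let $\mathcal{G}$ be an étale groupoid, let $\tau:\mathcal{G}^{(2)}\to\mathbb{T}$ be a normalized (continuous) $2$-cocycle on $\mathcal{G}$, let $(\mathcal{G},\Sigma)$ be the twisted groupoid associated to $\tau$ with corresponding Fell line bundle $L=\mathbb{C}\times\mathcal{G}$, and let $(\mathcal{C}_0(\mathcal{G}^{(0)}),S,\beta,\omega)$ be the twisted action associated to $(\mathcal{G},\Sigma)$ through the unitary sections $u_s$ of $L_s=\mathbb{C}\times s$ given by $u_s(\gamma)=(1,\gamma)$ for all $\gamma\in s$. Then $$\beta_s(a)(\mathrm{r}(\gamma))=a(\mathrm{d}(\gamma))\quad\text{and}\quad\omega(s,t)(\mathrm{r}(\alpha\beta))=\tau(\alpha,\beta)$$ for all $s,t\in S$, $a\in\mathcal{C}_0(s^*s)$, $\alpha,\gamma\in s$ and $\beta\in t$ with $\mathrm{d}(\alpha)=\mathrm{r}(\beta)$.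
   Context: An étale groupoid $\mathcal{G}$ is a topological groupoid, not necessarily Hausdorff, with locally compact Hausdorff unit space $\mathcal{G}^{(0)}$ and whose source and range maps $\mathrm{d},\mathrm{r}$ are local homeomorphisms; $\mathcal{G}^{(2)}$ is the set of composable pairs ($\mathrm{d}(\alpha)=\mathrm{r}(\beta)$). A bisection is an open set $s\subseteq\mathcal{G}$ on which $\mathrm{d},\mathrm{r}$ are homeomorphisms onto their images; bisections form an inverse semigroup under $st=\{\alpha\beta:\alpha\in s,\beta\in t,\mathrm{d}(\alpha)=\mathrm{r}(\beta)\}$, $s^*=\{\alpha^{-1}:\alpha\in s\}$. A $2$-cocycle is a continuous $\tau:\mathcal{G}^{(2)}\to\mathbb{T}$ with $\tau(\alpha,\beta)\tau(\alpha\beta,\gamma)=\tau(\beta,\gamma)\tau(\alpha,\beta\gamma)$ for $(\alpha,\beta),(\beta,\gamma)\in\mathcal{G}^{(2)}$; it is normalized if $\tau(\alpha,\mathrm{d}(\alpha))=\tau(\mathrm{r}(\alpha),\alpha)=1$ for all $\alpha$. The associated twist is $\Sigma=\mathbb{T}\times\mathcal{G}$ as a space, with $(\lambda,\alpha)(\mu,\beta)=(\lambda\mu\tau(\alpha,\beta),\alpha\beta)$ and $(\lambda,\alpha)^{-1}=(\overline{\lambda\tau(\alpha^{-1},\alpha)},\alpha^{-1})$. The corresponding Fell line bundle is $L=\mathbb{C}\times\mathcal{G}$ with $(\lambda,\alpha)\cdot(\mu,\beta)=(\lambda\mu\tau(\alpha,\beta),\alpha\beta)$ and $(\lambda,\alpha)^*=(\overline{\lambda\tau(\alpha^{-1},\alpha)},\alpha^{-1})$.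 $S$ is the inverse semigroup of all bisections $s$ of $\mathcal{G}$ over which $L$ is topologically trivial (here, all bisections), and $L_s$ is the restriction of $L$ to $s$. For bounded continuous sections $\xi$ of $L_s$ and $\eta$ of $L_t$, put $(\xi\cdot\eta)(\alpha\beta)=\xi(\alpha)\cdot\eta(\beta)$ for composable $\alpha\in s,\beta\in t$ (a section of $L_{st}$), and $\xi^*(\gamma)=\xi(\gamma^{-1})^*$ (a section of $L_{s^*}$). Sections of $L$ over open $e\subseteq\mathcal{G}^{(0)}$ are identified with functions on $e$ via $f\leftrightarrow(x\mapsto(f(x),x))$. The twisted action associated to $(\mathcal{G},\Sigma)$ through unitary sections $u_s$ of $L_s$ is: ideals $\mathcal{D}_s=\mathcal{C}_0(ss^* )$ of $\mathcal{C}_0(\mathcal{G}^{(0)})$; $\beta_s:\mathcal{C}_0(s^*s)\to\mathcal{C}_0(ss^* )$, $\beta_s(a)=u_s\cdot a\cdot u_s^*$; and $\omega(s,t)=u_s\cdot u_t\cdot u_{st}^*$, a continuous function $stt^*s^*\to\mathbb{T}$. *)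

theory Defs
  imports "HOL-Analysis.Analysis"
begin

section \<open>Etale groupoids\<close>

text \<open>The arrows are the points of the topology \<open>gtop\<close>, and a unit is identified with its identity
  arrow. The product is only meaningful on composable pairs, those with \<open>src G a = rng G b\<close>.\<close>

record 'g tgroupoid =
  gtop :: "'g topology"
  src :: "'g \<Rightarrow> 'g"
  rng :: "'g \<Rightarrow> 'g"
  gmul :: "'g \<Rightarrow> 'g \<Rightarrow> 'g"
  ginv :: "'g \<Rightarrow> 'g"

definition arr :: "'g tgroupoid \<Rightarrow> 'g set"
  where "arr G = topspace (gtop G)"

definition units :: "'g tgroupoid \<Rightarrow> 'g set"
  where "units G = src G ` arr G"

definition unit_space :: "'g tgroupoid \<Rightarrow> 'g topology"
  where "unit_space G = subtopology (gtop G) (units G)"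

definition composable :: "'g tgroupoid \<Rightarrow> ('g \<times> 'g) set"
  where "composable G = {(a, b). a \<in> arr G \<and> b \<in> arr G \<and> src G a = rng G b}"

definition composable_space :: "'g tgroupoid \<Rightarrow> ('g \<times> 'g) topology"
  where "composable_space G = subtopology (prod_topology (gtop G) (gtop G)) (composable G)"

locale groupoid =
  fixes G :: "'g tgroupoid"
  assumes src_arr: "a \<in> arr G \<Longrightarrow> src G a \<in> arr G"
    and rng_arr: "a \<in> arr G \<Longrightarrow> rng G a \<in> arr G"
    and src_src: "a \<in> arr G \<Longrightarrow> src G (src G a) = src G a"
    and rng_src: "a \<in> arr G \<Longrightarrow> rng G (src G a) = src G a"
    and src_rng: "a \<in> arr G \<Longrightarrow> src G (rng G a) = rng G a"
    and rng_rng: "a \<in> arr G \<Longrightarrow> rng G (rng G a) = rng G a"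
    and mul_arr: "(a, b) \<in> composable G \<Longrightarrow> gmul G a b \<in> arr G"
    and src_mul: "(a, b) \<in> composable G \<Longrightarrow> src G (gmul G a b) = src G b"
    and rng_mul: "(a, b) \<in> composable G \<Longrightarrow> rng G (gmul G a b) = rng G a"
    and mul_assoc: "\<lbrakk>(a, b) \<in> composable G; (b, c) \<in> composable G\<rbrakk>
      \<Longrightarrow> gmul G (gmul G a b) c = gmul G a (gmul G b c)"
    and mul_src: "a \<in> arr G \<Longrightarrow> gmul G a (src G a) = a"
    and rng_mul_self: "a \<in> arr G \<Longrightarrow> gmul G (rng G a) a = a"
    and inv_arr: "a \<in> arr G \<Longrightarrow> ginv G a \<in> arr G"
    and src_inv: "a \<in> arr G \<Longrightarrow> src G (ginv G a) = rng G a"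
    and rng_inv: "a \<in> arr G \<Longrightarrow> rng G (ginv G a) = src G a"
    and inv_mul: "a \<in> arr G \<Longrightarrow> gmul G (ginv G a) a = src G a"
    and mul_inv: "a \<in> arr G \<Longrightarrow> gmul G a (ginv G a) = rng G a"

locale topological_groupoid = groupoid +
  assumes continuous_mul: "continuous_map (composable_space G) (gtop G) (\<lambda>(a, b). gmul G a b)"
    and continuous_inv: "continuous_map (gtop G) (gtop G) (ginv G)"

definition local_homeomorphism :: "'a topology \<Rightarrow> 'b topology \<Rightarrow> ('a \<Rightarrow> 'b) \<Rightarrow> bool"
  where "local_homeomorphism X Y f \<longleftrightarrow>
    (\<forall>x \<in> topspace X. \<exists>U. openin X U \<and> x \<in> U \<and> openin Y (f ` U) \<and>
      homeomorphic_map (subtopology X U) (subtopology Y (f ` U)) f)"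

text \<open>Only the unit space is required to be Hausdorff, not the space of all arrows.\<close>

locale etale_groupoid = topological_groupoid +
  assumes locally_compact_units: "locally_compact_space (unit_space G)"
    and Hausdorff_units: "Hausdorff_space (unit_space G)"
    and src_local_homeo: "local_homeomorphism (gtop G) (unit_space G) (src G)"
    and rng_local_homeo: "local_homeomorphism (gtop G) (unit_space G) (rng G)"

definition bisection :: "'g tgroupoid \<Rightarrow> 'g set \<Rightarrow> bool"
  where "bisection G s \<longleftrightarrow> openin (gtop G) s \<and>
    homeomorphic_map (subtopology (gtop G) s) (subtopology (unit_space G) (src G ` s)) (src G) \<and>
    homeomorphic_map (subtopology (gtop G) s) (subtopology (unit_space G) (rng G ` s)) (rng G)"

definition set_mul :: "'g tgroupoid \<Rightarrow> 'g set \<Rightarrow> 'g set \<Rightarrow> 'g set"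
  where "set_mul G s t = {gmul G a b | a b. a \<in> s \<and> b \<in> t \<and> src G a = rng G b}"

definition set_star :: "'g tgroupoid \<Rightarrow> 'g set \<Rightarrow> 'g set"
  where "set_star G s = ginv G ` s"

section \<open>Cocycles, twists and Fell line bundles\<close>

definition two_cocycle :: "'g tgroupoid \<Rightarrow> ('g \<Rightarrow> 'g \<Rightarrow> complex) \<Rightarrow> bool"
  where "two_cocycle G \<tau> \<longleftrightarrow>
    continuous_map (composable_space G) (top_of_set (sphere 0 1)) (\<lambda>(a, b). \<tau> a b) \<and>
    (\<forall>a b c. (a, b) \<in> composable G \<and> (b, c) \<in> composable G \<longrightarrow>
      \<tau> a b * \<tau> (gmul G a b) c = \<tau> b c * \<tau> a (gmul G b c))"

definition normalized_two_cocycle :: "'g tgroupoid \<Rightarrow> ('g \<Rightarrow> 'g \<Rightarrow> complex) \<Rightarrow> bool"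
  where "normalized_two_cocycle G \<tau> \<longleftrightarrow> two_cocycle G \<tau> \<and>
    (\<forall>a \<in> arr G. \<tau> a (src G a) = 1 \<and> \<tau> (rng G a) a = 1)"

definition line_bundle :: "'g tgroupoid \<Rightarrow> (complex \<times> 'g) topology"
  where "line_bundle G = prod_topology euclidean (gtop G)"

definition bundle_mul ::
  "'g tgroupoid \<Rightarrow> ('g \<Rightarrow> 'g \<Rightarrow> complex) \<Rightarrow> complex \<times> 'g \<Rightarrow> complex \<times> 'g \<Rightarrow> complex \<times> 'g"
  where "bundle_mul G \<tau> p q = (fst p * fst q * \<tau> (snd p) (snd q), gmul G (snd p) (snd q))"

definition bundle_star ::
  "'g tgroupoid \<Rightarrow> ('g \<Rightarrow> 'g \<Rightarrow> complex) \<Rightarrow> complex \<times> 'g \<Rightarrow> complex \<times> 'g"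
  where "bundle_star G \<tau> p = (cnj (fst p * \<tau> (ginv G (snd p)) (snd p)), ginv G (snd p))"

text \<open>The twist is the unit circle bundle of the line bundle: the same formulas give its product and
  inverse. Since \<open>\<tau>\<close> is normalized, the units of the twist are the points \<open>(1, x)\<close> with \<open>x\<close> a unit.\<close>

definition twist :: "'g tgroupoid \<Rightarrow> ('g \<Rightarrow> 'g \<Rightarrow> complex) \<Rightarrow> (complex \<times> 'g) tgroupoid"
  where "twist G \<tau> =
    \<lparr>gtop = prod_topology (top_of_set (sphere 0 1)) (gtop G),
     src = (\<lambda>p. (1, src G (snd p))),
     rng = (\<lambda>p. (1, rng G (snd p))),
     gmul = bundle_mul G \<tau>,
     ginv = bundle_star G \<tau>\<rparr>"

section \<open>Sections\<close>

text \<open>A section over an open set \<open>s\<close> is a function on all arrows, of which only the values on \<open>s\<close>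
  matter. Products and adjoints of sections are extended by zero off their domain.\<close>

definition continuous_section :: "'g tgroupoid \<Rightarrow> 'g set \<Rightarrow> ('g \<Rightarrow> complex \<times> 'g) \<Rightarrow> bool"
  where "continuous_section G s \<xi> \<longleftrightarrow>
    continuous_map (subtopology (gtop G) s) (line_bundle G) \<xi> \<and> (\<forall>a \<in> s. snd (\<xi> a) = a)"

definition unitary_section ::
  "'g tgroupoid \<Rightarrow> ('g \<Rightarrow> 'g \<Rightarrow> complex) \<Rightarrow> 'g set \<Rightarrow> ('g \<Rightarrow> complex \<times> 'g) \<Rightarrow> bool"
  where "unitary_section G \<tau> s u \<longleftrightarrow>
    continuous_section G s u \<and> (\<forall>a \<in> s. u a \<in> arr (twist G \<tau>))"

text \<open>If \<open>s\<close> and \<open>t\<close> are bisections, then each element of \<open>set_mul G s t\<close> has a unique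
  factorization, so that the definite description below denotes it.\<close>

definition section_mul ::
  "'g tgroupoid \<Rightarrow> ('g \<Rightarrow> 'g \<Rightarrow> complex) \<Rightarrow> 'g set \<Rightarrow> 'g set \<Rightarrow>
    ('g \<Rightarrow> complex \<times> 'g) \<Rightarrow> ('g \<Rightarrow> complex \<times> 'g) \<Rightarrow> 'g \<Rightarrow> complex \<times> 'g"
  where "section_mul G \<tau> s t \<xi> \<eta> c =
    (if c \<in> set_mul G s t
     then let (a, b) = (THE (a, b). a \<in> s \<and> b \<in> t \<and> src G a = rng G b \<and> gmul G a b = c)
          in bundle_mul G \<tau> (\<xi> a) (\<eta> b)
     else (0, c))"

definition section_star ::
  "'g tgroupoid \<Rightarrow> ('g \<Rightarrow> 'g \<Rightarrow> complex) \<Rightarrow> 'g set \<Rightarrow>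
    ('g \<Rightarrow> complex \<times> 'g) \<Rightarrow> 'g \<Rightarrow> complex \<times> 'g"
  where "section_star G \<tau> s \<xi> c =
    (if c \<in> set_star G s then bundle_star G \<tau> (\<xi> (ginv G c)) else (0, c))"

definition section_of_fun :: "('g \<Rightarrow> complex) \<Rightarrow> 'g \<Rightarrow> complex \<times> 'g"
  where "section_of_fun f = (\<lambda>x. (f x, x))"

definition fun_of_section :: "('g \<Rightarrow> complex \<times> 'g) \<Rightarrow> 'g \<Rightarrow> complex"
  where "fun_of_section \<xi> = (\<lambda>x. fst (\<xi> x))"

section \<open>The associated twisted action\<close>

text \<open>Elements of \<open>C0 X\<close> are extended by zero off \<open>X\<close>. In this way, for open \<open>e \<subseteq> units G\<close>, the algebra
  \<open>C0_on G e\<close> is an ideal of \<open>C0 (unit_space G)\<close>.\<close>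

definition C0 :: "'g topology \<Rightarrow> ('g \<Rightarrow> complex) set"
  where "C0 X = {f. continuous_map X euclidean f \<and>
    (\<forall>\<epsilon>>0. compactin X {x \<in> topspace X. \<epsilon> \<le> norm (f x)}) \<and>
    (\<forall>x. x \<notin> topspace X \<longrightarrow> f x = 0)}"

definition C0_on :: "'g tgroupoid \<Rightarrow> 'g set \<Rightarrow> ('g \<Rightarrow> complex) set"
  where "C0_on G e = C0 (subtopology (gtop G) e)"

definition action_beta ::
  "'g tgroupoid \<Rightarrow> ('g \<Rightarrow> 'g \<Rightarrow> complex) \<Rightarrow> ('g set \<Rightarrow> 'g \<Rightarrow> complex \<times> 'g) \<Rightarrow>
    'g set \<Rightarrow> ('g \<Rightarrow> complex) \<Rightarrow> 'g \<Rightarrow> complex"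
  where "action_beta G \<tau> u s =
    (let e = set_mul G (set_star G s) s in
      restrict (\<lambda>a. fun_of_section
        (section_mul G \<tau> (set_mul G s e) (set_star G s)
          (section_mul G \<tau> s e (u s) (section_of_fun a))
          (section_star G \<tau> s (u s)))) (C0_on G e))"

definition action_omega ::
  "'g tgroupoid \<Rightarrow> ('g \<Rightarrow> 'g \<Rightarrow> complex) \<Rightarrow> ('g set \<Rightarrow> 'g \<Rightarrow> complex \<times> 'g) \<Rightarrow>
    'g set \<Rightarrow> 'g set \<Rightarrow> 'g \<Rightarrow> complex"
  where "action_omega G \<tau> u s t =
    (let st = set_mul G s t in
      fun_of_section
        (section_mul G \<tau> st (set_star G st)
          (section_mul G \<tau> s t (u s) (u t))
          (section_star G \<tau> st (u st))))"

text \<open>The line bundle of a cocycle is trivial over every bisection (see \<open>unitary_section_one\<close> below),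
  so the inverse semigroup acting is that of all bisections.\<close>

definition associated_twisted_action ::
  "'g tgroupoid \<Rightarrow> ('g \<Rightarrow> 'g \<Rightarrow> complex) \<Rightarrow> ('g set \<Rightarrow> 'g \<Rightarrow> complex \<times> 'g) \<Rightarrow>
    ('g \<Rightarrow> complex) set \<times> 'g set set \<times>
    ('g set \<Rightarrow> ('g \<Rightarrow> complex) \<Rightarrow> 'g \<Rightarrow> complex) \<times> ('g set \<Rightarrow> 'g set \<Rightarrow> 'g \<Rightarrow> complex)"
  where "associated_twisted_action G \<tau> u =
    (C0 (unit_space G), {s. bisection G s}, action_beta G \<tau> u, action_omega G \<tau> u)"

definition one_section :: "'g set \<Rightarrow> 'g \<Rightarrow> complex \<times> 'g"
  where "one_section s = (\<lambda>a. if a \<in> s then (1, a) else (0, a))"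

lemma unitary_section_one:
  assumes "bisection G s"
  shows "unitary_section G \<tau> s (one_section s)"
proof -
  have s: "s \<subseteq> topspace (gtop G)"
    using assms openin_subset by (auto simp: bisection_def)
  have "continuous_map (subtopology (gtop G) s) (prod_topology euclidean (gtop G)) (\<lambda>a. (1, a))"
    by (intro continuous_map_pairedI continuous_map_from_subtopology) auto
  then have "continuous_map (subtopology (gtop G) s) (line_bundle G) (one_section s)"
    unfolding line_bundle_def
    by (rule continuous_map_eq) (auto simp: one_section_def)
  then show ?thesis
    using s by (auto simp: unitary_section_def continuous_section_def one_section_def arr_def twist_def)
qed

end

theory Submission
  imports Defs
begin

text \<open>
  Both identities are instances of one cancellation. An element \<open>w\<close> of a bisection \<open>s\<close> is the only
  one with its range, so the value at \<open>rng G w\<close> of a product \<open>\<xi> \<cdot> u\<^sub>s\<^sup>*\<close> comes from the single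
  factorization of \<open>rng G w\<close> as \<open>w\<close> times its inverse. If \<open>\<xi> w = (\<lambda>, w)\<close>, that value is
  \<open>\<lambda> \<cdot> cnj (\<tau>(w\<^sup>-\<^sup>1, w)) \<cdot> \<tau>(w, w\<^sup>-\<^sup>1)\<close>. The cocycle identity at the triple \<open>(w, w\<^sup>-\<^sup>1, w)\<close>, together with
  normalization, gives \<open>\<tau>(w, w\<^sup>-\<^sup>1) = \<tau>(w\<^sup>-\<^sup>1, w)\<close>; as \<open>\<tau>\<close> has modulus one, the two factors cancel and
  \<open>\<lambda>\<close> remains (lemma \<open>section_mul_star_one_section\<close>).

  It is left to compute \<open>\<lambda>\<close>. For \<open>\<beta>\<close> one takes \<open>\<xi> = u\<^sub>s \<cdot> a\<close>, whose coefficient at \<open>z\<close> is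
  \<open>a(src z) \<cdot> \<tau>(z, src z) = a(src z)\<close> by normalization. For \<open>\<omega>\<close> one takes \<open>\<xi> = u\<^sub>s \<cdot> u\<^sub>t\<close>, whose
  coefficient at \<open>xy\<close> is \<open>\<tau>(x, y)\<close>.

  Products of sections are unambiguous because source and range are injective on a bisection. Sets
  of arrows with this property (slices) are closed under products and adjoints by groupoid algebra,
  so the products of more than two sections can be evaluated one factor at a time.
\<close>

section \<open>Slices of a groupoid\<close>

context groupoid
begin

lemma composableI: "a \<in> arr G \<Longrightarrow> b \<in> arr G \<Longrightarrow> src G a = rng G b \<Longrightarrow> (a, b) \<in> composable G"
  by (simp add: composable_def)

lemma inv_inv:
  assumes a: "a \<in> arr G"
  shows "ginv G (ginv G a) = a"
proof -
  let ?b = "ginv G a" and ?c = "ginv G (ginv G a)"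
  have b: "?b \<in> arr G" and c: "?c \<in> arr G"
    using a by (simp_all add: inv_arr)
  have "?c = gmul G ?c (src G a)"
    using mul_src[OF c] a b by (simp add: src_inv rng_inv)
  also have "\<dots> = gmul G ?c (gmul G ?b a)"
    using a by (simp add: inv_mul)
  also have "\<dots> = gmul G (gmul G ?c ?b) a"
    using a b c by (intro mul_assoc[symmetric] composableI) (simp_all add: src_inv rng_inv)
  also have "\<dots> = gmul G (rng G a) a"
    using a b by (simp add: inv_mul src_inv)
  also have "\<dots> = a"
    using a by (rule rng_mul_self)
  finally show ?thesis .
qed

end

definition slice :: "'g tgroupoid \<Rightarrow> 'g set \<Rightarrow> bool"
  where "slice G s \<longleftrightarrow> s \<subseteq> arr G \<and> inj_on (src G) s \<and> inj_on (rng G) s"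

lemma slice_arr: "slice G s \<Longrightarrow> a \<in> s \<Longrightarrow> a \<in> arr G"
  by (auto simp: slice_def)

lemma bisection_imp_slice:
  assumes "bisection G s"
  shows "slice G s"
proof -
  have sub: "s \<subseteq> topspace (gtop G)"
    using assms openin_subset by (auto simp: bisection_def)
  have "inj_on (src G) s" "inj_on (rng G) s"
    using assms sub
    by (auto simp: bisection_def Int_absorb1 dest!: homeomorphic_imp_injective_map)
  with sub show ?thesis
    by (simp add: slice_def arr_def)
qed

lemma set_mulI: "a \<in> s \<Longrightarrow> b \<in> t \<Longrightarrow> src G a = rng G b \<Longrightarrow> gmul G a b \<in> set_mul G s t"
  by (auto simp: set_mul_def)

lemma set_starI: "a \<in> s \<Longrightarrow> ginv G a \<in> set_star G s"
  by (simp add: set_star_def)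

context groupoid
begin

lemma slice_set_star:
  assumes s: "slice G s"
  shows "slice G (set_star G s)"
  using s by (auto simp: slice_def set_star_def inj_on_def subset_iff inv_arr src_inv rng_inv)

text \<open>The range of \<open>ab\<close> determines \<open>a\<close>, hence the range \<open>src G a\<close> of \<open>b\<close>, hence \<open>b\<close>; the source of
  \<open>ab\<close> determines the two factors in the opposite order.\<close>

lemma slice_set_mul:
  assumes s: "slice G s" and t: "slice G t"
  shows "slice G (set_mul G s t)"
proof -
  have comp: "(a, b) \<in> composable G" if "a \<in> s" "b \<in> t" "src G a = rng G b" for a b
    using that slice_arr[OF s] slice_arr[OF t] by (intro composableI)
  have "set_mul G s t \<subseteq> arr G"
    using comp by (auto simp: set_mul_def intro: mul_arr)
  moreover have "inj_on (rng G) (set_mul G s t)"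
  proof (rule inj_onI)
    fix c c' assume "c \<in> set_mul G s t" "c' \<in> set_mul G s t" and eq: "rng G c = rng G c'"
    then obtain a b a' b' where
      ab: "c = gmul G a b" "a \<in> s" "b \<in> t" "src G a = rng G b" and
      ab': "c' = gmul G a' b'" "a' \<in> s" "b' \<in> t" "src G a' = rng G b'"
      by (auto simp: set_mul_def)
    have "rng G a = rng G a'"
      using eq ab ab' comp by (simp add: rng_mul)
    then have a: "a = a'"
      using s ab ab' by (auto simp: slice_def dest: inj_onD)
    then have "b = b'"
      using t ab ab' by (auto simp: slice_def dest: inj_onD)
    with a show "c = c'"
      using ab ab' by simp
  qed
  moreover have "inj_on (src G) (set_mul G s t)"
  proof (rule inj_onI)
    fix c c' assume "c \<in> set_mul G s t" "c' \<in> set_mul G s t" and eq: "src G c = src G c'"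
    then obtain a b a' b' where
      ab: "c = gmul G a b" "a \<in> s" "b \<in> t" "src G a = rng G b" and
      ab': "c' = gmul G a' b'" "a' \<in> s" "b' \<in> t" "src G a' = rng G b'"
      by (auto simp: set_mul_def)
    have "src G b = src G b'"
      using eq ab ab' comp by (simp add: src_mul)
    then have b: "b = b'"
      using t ab ab' by (auto simp: slice_def dest: inj_onD)
    then have "a = a'"
      using s ab ab' inj_onD[of "src G" s a a'] by (simp add: slice_def)
    with b show "c = c'"
      using ab ab' by simp
  qed
  ultimately show ?thesis
    by (simp add: slice_def)
qed

section \<open>Products of sections over slices\<close>

text \<open>Any factorization of \<open>xy\<close> over \<open>s\<close> and \<open>t\<close> has first factor of range \<open>rng G x\<close> and second
  factor of source \<open>src G y\<close>, so it is \<open>(x, y)\<close>.\<close>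

lemma section_mul_apply:
  assumes s: "slice G s" and t: "slice G t"
    and x: "x \<in> s" and y: "y \<in> t" and xy: "src G x = rng G y"
  shows "section_mul G \<tau> s t \<xi> \<eta> (gmul G x y) = bundle_mul G \<tau> (\<xi> x) (\<eta> y)"
proof -
  let ?P = "\<lambda>(a, b). a \<in> s \<and> b \<in> t \<and> src G a = rng G b \<and> gmul G a b = gmul G x y"
  have comp: "(a, b) \<in> composable G" if "a \<in> s" "b \<in> t" "src G a = rng G b" for a b
    using that slice_arr[OF s] slice_arr[OF t] by (intro composableI)
  have "(THE p. ?P p) = (x, y)"
  proof (rule the_equality)
    show "?P (x, y)"
      using x y xy by simp
  next
    fix p assume "?P p"
    then obtain a b where p: "p = (a, b)" and
      ab: "a \<in> s" "b \<in> t" "src G a = rng G b" "gmul G a b = gmul G x y"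
      by auto
    have "rng G a = rng G x" "src G b = src G y"
      using ab comp[OF ab(1-3)] comp[OF x y xy] by (metis rng_mul, metis src_mul)
    then show "p = (x, y)"
      using s t ab x y p by (auto simp: slice_def dest: inj_onD)
  qed
  then show ?thesis
    using set_mulI[OF x y xy] by (simp add: section_mul_def)
qed

lemma section_star_one_section:
  assumes "slice G s" "z \<in> s"
  shows "section_star G \<tau> s (one_section s) (ginv G z) = (cnj (\<tau> (ginv G z) z), ginv G z)"
  using assms inv_inv[OF slice_arr[OF assms]]
  by (simp add: section_star_def set_starI one_section_def bundle_star_def)

end

section \<open>Cancellation of the cocycle\<close>

lemma two_cocycle_norm:
  assumes \<tau>: "two_cocycle G \<tau>" and ab: "(a, b) \<in> composable G"
  shows "norm (\<tau> a b) = 1"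
proof -
  have "(a, b) \<in> topspace (composable_space G)"
    using ab by (auto simp: composable_space_def composable_def arr_def)
  moreover have "continuous_map (composable_space G) (top_of_set (sphere 0 1)) (\<lambda>(a, b). \<tau> a b)"
    using \<tau> by (simp add: two_cocycle_def)
  ultimately have "(\<lambda>(a, b). \<tau> a b) (a, b) \<in> topspace (top_of_set (sphere 0 1))"
    by (meson continuous_map PiE image_subset_iff)
  then show ?thesis
    by simp
qed

context groupoid
begin

lemma normalized_two_cocycle_inv_commute:
  assumes \<tau>: "normalized_two_cocycle G \<tau>" and z: "z \<in> arr G"
  shows "\<tau> z (ginv G z) = \<tau> (ginv G z) z"
proof -
  have "(z, ginv G z) \<in> composable G" "(ginv G z, z) \<in> composable G"
    using z by (auto intro!: composableI simp: inv_arr src_inv rng_inv)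
  then have "\<tau> z (ginv G z) * \<tau> (gmul G z (ginv G z)) z
      = \<tau> (ginv G z) z * \<tau> z (gmul G (ginv G z) z)"
    using \<tau> by (simp add: normalized_two_cocycle_def two_cocycle_def)
  then show ?thesis
    using \<tau> z by (simp add: normalized_two_cocycle_def mul_inv inv_mul)
qed

text \<open>The set \<open>w\<close> over which \<open>\<xi>\<close> is multiplied may differ from \<open>s\<close>: over \<open>s \<cdot> s\<^sup>*s\<close>, which is again
  \<open>s\<close>, the lemma applies without an identification of the two sets.\<close>

lemma section_mul_star_one_section:
  assumes \<tau>: "normalized_two_cocycle G \<tau>"
    and w: "slice G w" and s: "slice G s" and zw: "z \<in> w" and zs: "z \<in> s"
    and \<xi>: "\<xi> z = (c, z)"
  shows "section_mul G \<tau> w (set_star G s) \<xi> (section_star G \<tau> s (one_section s)) (rng G z)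
    = (c, rng G z)"
proof -
  have z: "z \<in> arr G"
    using slice_arr[OF s zs] .
  have "(ginv G z, z) \<in> composable G"
    using z by (intro composableI) (auto simp: inv_arr src_inv)
  then have "norm (\<tau> (ginv G z) z) = 1"
    using \<tau> two_cocycle_norm by (auto simp: normalized_two_cocycle_def)
  then have unit: "cnj (\<tau> (ginv G z) z) * \<tau> (ginv G z) z = 1"
    using complex_norm_square[of "\<tau> (ginv G z) z"] by (simp add: mult.commute)
  have "section_mul G \<tau> w (set_star G s) \<xi> (section_star G \<tau> s (one_section s))
      (gmul G z (ginv G z))
    = bundle_mul G \<tau> (\<xi> z) (section_star G \<tau> s (one_section s) (ginv G z))"
    using z by (intro section_mul_apply w slice_set_star s zw set_starI zs) (simp add: rng_inv)
  also have "\<dots> = (c * (cnj (\<tau> (ginv G z) z) * \<tau> (ginv G z) z), gmul G z (ginv G z))"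
    using normalized_two_cocycle_inv_commute[OF \<tau> z]
    by (simp add: section_star_one_section[OF s zs] \<xi> bundle_mul_def mult.assoc)
  finally show ?thesis
    using z unit by (simp add: mul_inv)
qed

section \<open>The twisted action of a cocycle\<close>

lemma action_beta_one_section:
  assumes \<tau>: "normalized_two_cocycle G \<tau>" and s: "slice G s" and z: "z \<in> s"
    and a: "a \<in> C0_on G (set_mul G (set_star G s) s)"
  shows "action_beta G \<tau> one_section s a (rng G z) = a (src G z)"
proof -
  let ?e = "set_mul G (set_star G s) s"
  let ?ua = "section_mul G \<tau> s ?e (one_section s) (section_of_fun a)"
  have zarr: "z \<in> arr G"
    using slice_arr[OF s z] .
  have e: "slice G ?e"
    by (intro slice_set_mul slice_set_star s)
  have "gmul G (ginv G z) z \<in> ?e"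
    using z zarr by (intro set_mulI set_starI) (simp_all add: src_inv)
  then have dz: "src G z \<in> ?e"
    using zarr by (simp add: inv_mul)
  have comp: "src G z = rng G (src G z)"
    using zarr by (simp add: rng_src)
  have zmul: "gmul G z (src G z) = z"
    using zarr by (rule mul_src)
  have zse: "z \<in> set_mul G s ?e"
    using set_mulI[OF z dz comp] by (simp add: zmul)
  have "?ua (gmul G z (src G z)) = bundle_mul G \<tau> (one_section s z) (section_of_fun a (src G z))"
    by (rule section_mul_apply[OF s e z dz comp])
  then have "?ua z = (a (src G z), z)"
    using \<tau> zarr z
    by (simp add: zmul one_section_def section_of_fun_def bundle_mul_def normalized_two_cocycle_def)
  then show ?thesis
    using section_mul_star_one_section[OF \<tau> slice_set_mul[OF s e] s zse z] a
    by (simp add: action_beta_def Let_def fun_of_section_def)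
qed

lemma action_omega_one_section:
  assumes \<tau>: "normalized_two_cocycle G \<tau>" and s: "slice G s" and t: "slice G t"
    and x: "x \<in> s" and y: "y \<in> t" and xy: "src G x = rng G y"
  shows "action_omega G \<tau> one_section s t (rng G (gmul G x y)) = \<tau> x y"
proof -
  let ?uu = "section_mul G \<tau> s t (one_section s) (one_section t)"
  have "?uu (gmul G x y) = (\<tau> x y, gmul G x y)"
    using x y section_mul_apply[OF s t x y xy, where \<xi> = "one_section s" and \<eta> = "one_section t"]
    by (simp add: one_section_def bundle_mul_def)
  moreover have "gmul G x y \<in> set_mul G s t"
    using x y xy by (rule set_mulI)
  ultimately show ?thesis
    using section_mul_star_one_section[OF \<tau> slice_set_mul[OF s t] slice_set_mul[OF s t]]
    by (simp add: action_omega_def Let_def fun_of_section_def)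
qed

end

theorem proposition7p7:
  fixes G :: "'g tgroupoid" and \<tau> :: "'g \<Rightarrow> 'g \<Rightarrow> complex"
    and A :: "('g \<Rightarrow> complex) set" and S :: "'g set set"
    and \<beta> :: "'g set \<Rightarrow> ('g \<Rightarrow> complex) \<Rightarrow> 'g \<Rightarrow> complex"
    and \<omega> :: "'g set \<Rightarrow> 'g set \<Rightarrow> 'g \<Rightarrow> complex"
  assumes "etale_groupoid G"
    and "normalized_two_cocycle G \<tau>"
    and "(A, S, \<beta>, \<omega>) = associated_twisted_action G \<tau> one_section"
  shows "(\<forall>s \<in> S. \<forall>a \<in> C0_on G (set_mul G (set_star G s) s). \<forall>z \<in> s.
        \<beta> s a (rng G z) = a (src G z)) \<and>
    (\<forall>s \<in> S. \<forall>t \<in> S. \<forall>x \<in> s. \<forall>y \<in> t. src G x = rng G y \<longrightarrow>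
        \<omega> s t (rng G (gmul G x y)) = \<tau> x y)"
proof -
  interpret etale_groupoid G
    by (rule assms(1))
  have "S = {s. bisection G s}"
    and \<beta>: "\<beta> = action_beta G \<tau> one_section" and \<omega>: "\<omega> = action_omega G \<tau> one_section"
    using assms(3) by (simp_all add: associated_twisted_action_def)
  then have "slice G s" if "s \<in> S" for s
    using that bisection_imp_slice by blast
  then show ?thesis
    unfolding \<beta> \<omega>
    by (blast intro: action_beta_one_section action_omega_one_section assms(2))
qed

end
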